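(* Let $\mathcal G=(V,\omega)$ be a connected finite graph, and let $p\ge2$. If the spectrum of $\Delta_{2,\omega}$ is contained in $\{0\}\cup[1-\varepsilon,1+\varepsilon]$ for some $\varepsilon>0$, then $$\lambda_{1,p}(\mathcal G)\ \ge\ \left(1-2^{1-\frac2p}\varepsilon^{\frac2p}\right)^p\left(\frac12+2^{1-p}\right).$$ In particular, $\lambda_{1,p}(\mathcal G)>\frac12$ if $\varepsilon\le 2p^{-\frac p2}2^{-\frac{p^2}2}$.
   Context: A finite (weighted) graph is $\mathcal G=(V,\omega)$ with $V$ finite and $\omega:V\times V\to[0,\infty)$ symmetric; $d_\omega(s)=\sum_t\omega(s,t)$ is the degree of $s$. The normalized Laplacian is $\Delta_{2,\omega}f(s)=f(s)-\frac1{d_\omega(s)}\sum_t\omega(s,t)f(t)$. For $\alpha>0$ write $\{z\}^\alpha=|z|^{\alpha-1}z$ if $z\ne0$ and $\{0\}^\alpha=0$. For $1<p<\infty$ the $p$-Laplacian is the nonlinear map $\Delta_p:\mathbb R^V\to\mathbb R^V$, $\Delta_pf(s)=\frac1{d_\omega(s)}\sum_t\omega(s,t)\{f(s)-f(t)\}^{p-1}$. A real $\lambda$ is an eigenvalue of $\Delta_p$ if there is $f\ne0$ with $\Delta_pf=\lambda\{f\}^{p-1}$ (pointwise), and $\lambda_{1,p}(\mathcal G)$ is the smallest nonzero eigenvalue of $\Delta_p$.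
   Formalization: The base 1 − 2^{1−2/p} ε^{2/p} is replaced by its maximum with 0, since for a negative base the power is undefined or the bound false (p = 2, ε = 10 would give 81); the graph is assumed to have at least two vertices so that λ_{1,p} exists. *)

theory Defs
  imports Complex_Main "HOL-Library.Cardinality"
begin

text \<open>
  The vertex set is a finite type \<open>'v\<close>, so that the space of real functions on the vertices
  is the function type \<open>'v \<Rightarrow> real\<close>. A graph is given by its weight function; loops
  (\<open>\<omega> s s > 0\<close>) are allowed, and \<open>s\<close>, \<open>t\<close> are adjacent iff \<open>\<omega> s t > 0\<close>.
\<close>

definition weighted_graph :: "('v::finite \<Rightarrow> 'v \<Rightarrow> real) \<Rightarrow> bool" where
  "weighted_graph \<omega> \<longleftrightarrow> (\<forall>s t. 0 \<le> \<omega> s t) \<and> (\<forall>s t. \<omega> s t = \<omega> t s)"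

definition connected_graph :: "('v::finite \<Rightarrow> 'v \<Rightarrow> real) \<Rightarrow> bool" where
  "connected_graph \<omega> \<longleftrightarrow> (\<forall>s t. (s, t) \<in> {(x, y). \<omega> x y > 0}\<^sup>*)"

definition graph_degree :: "('v::finite \<Rightarrow> 'v \<Rightarrow> real) \<Rightarrow> 'v \<Rightarrow> real" where
  "graph_degree \<omega> s = (\<Sum>t\<in>UNIV. \<omega> s t)"

definition normalized_laplacian ::
    "('v::finite \<Rightarrow> 'v \<Rightarrow> real) \<Rightarrow> ('v \<Rightarrow> real) \<Rightarrow> 'v \<Rightarrow> real" where
  "normalized_laplacian \<omega> f s = f s - 1 / graph_degree \<omega> s * (\<Sum>t\<in>UNIV. \<omega> s t * f t)"

text \<open>
  The normalized Laplacian is a linear map on a finite-dimensional space, self-adjoint for the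
  inner product weighted by the degree, so its spectrum is its set of real eigenvalues.
\<close>

definition laplacian_spectrum :: "('v::finite \<Rightarrow> 'v \<Rightarrow> real) \<Rightarrow> real set" where
  "laplacian_spectrum \<omega> =
     {\<mu>. \<exists>f. f \<noteq> (\<lambda>_. 0) \<and> (\<forall>s. normalized_laplacian \<omega> f s = \<mu> * f s)}"

definition signed_power :: "real \<Rightarrow> real \<Rightarrow> real" where
  "signed_power z \<alpha> = (if z = 0 then 0 else \<bar>z\<bar> powr (\<alpha> - 1) * z)"

definition p_laplacian ::
    "real \<Rightarrow> ('v::finite \<Rightarrow> 'v \<Rightarrow> real) \<Rightarrow> ('v \<Rightarrow> real) \<Rightarrow> 'v \<Rightarrow> real" where
  "p_laplacian p \<omega> f s =
     1 / graph_degree \<omega> s * (\<Sum>t\<in>UNIV. \<omega> s t * signed_power (f s - f t) (p - 1))"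

definition p_laplacian_eigenvalue ::
    "real \<Rightarrow> ('v::finite \<Rightarrow> 'v \<Rightarrow> real) \<Rightarrow> real \<Rightarrow> bool" where
  "p_laplacian_eigenvalue p \<omega> \<mu> \<longleftrightarrow>
     (\<exists>f. f \<noteq> (\<lambda>_. 0) \<and> (\<forall>s. p_laplacian p \<omega> f s = \<mu> * signed_power (f s) (p - 1)))"

text \<open>
  As \<open>LEAST\<close> is unspecified when no minimum exists, bounding \<open>lambda1\<close> requires proving
  the existence of a smallest nonzero eigenvalue. A one-vertex graph has none.
\<close>

definition lambda1 :: "real \<Rightarrow> ('v::finite \<Rightarrow> 'v \<Rightarrow> real) \<Rightarrow> real" where
  "lambda1 p \<omega> = (LEAST \<mu>. \<mu> \<noteq> 0 \<and> p_laplacian_eigenvalue p \<omega> \<mu>)"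

end

theory Submission
  imports Defs "HOL-Analysis.Analysis"
begin

text \<open>
  Write $d$ for the degree, $\{z\}^a$ for the signed power, $A$ for the averaging operator of the
  random walk, $A_0$ for the projection onto constants (the mean with respect to $d$), and
  $T = A - A_0$. All norms are those of $L^p(V, d)$.

  Let $f$ be an eigenfunction of $\Delta_p$ for $\lambda \ne 0$. Pairing the eigenvalue equation
  with $f$ gives $\lambda \|f\|_p^p = \frac12 \sum_{s,t} \omega(s,t) |f(s) - f(t)|^p$, and pairing it
  with $1$ gives $\sum_s d(s) \{f(s)\}^{p-1} = 0$, which says that $\|f - c\|_p$ is smallest at
  $c = 0$. The convexity inequality
  $$|x + h|^p \ge |x|^p + p \{x\}^{p-1} h + 2^{2-p} |h|^p$$
  (\<open>abs_powr_tangent\<close>) is applied with $x = f(s) - Af(s)$ and $h = Af(s) - f(t)$. The middle term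
  averages to $0$ over $t$, so the energy dominates
  $\frac12 \|f - Af\|_p^p + 2^{1-p} \sum_{s,t} \omega(s,t) |Af(s) - f(t)|^p$. If $\|T\|_p \le \delta < 1$,
  replacing $Af$ by $A_0 f$ costs at most the factor $(1 - \delta)^p$ in either term, and both terms then
  become $\|f - A_0 f\|_p^p \ge \|f\|_p^p$. Hence $\lambda \ge (1-\delta)^p (\frac12 + 2^{1-p})$
  (\<open>eigenvalue_lower_bound\<close>).

  It remains to show $\|T\|_p^p \le 2^{p-2} \varepsilon^2$ (\<open>fluct_Lp_bound\<close>), the interpolation
  between $\|T\|_2 \le \varepsilon$ and $\|T\|_\infty \le 2$. The Riesz-Thorin theorem is replaced by an
  argument with extremisers: if $f$ maximises $\|Tf\|_p^p / \|f\|_p^p$ with maximum $m$, the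
  Euler-Lagrange equation reads $T \{Tf\}^{p-1} = m \{f\}^{p-1}$ because $T$ is self-adjoint. Taking
  $L^2$ norms gives
  $$m^2 \|f\|_q^q \le \varepsilon^2 \|Tf\|_q^q, \qquad q = 2p - 2,$$
  so a bound for the exponent $2p - 2$ yields one for $p$ (\<open>fluct_interpolation\<close>). Since
  $q - 2 = 2 (p - 2)$, iterating drives the exponent to infinity, and starting the iteration far out
  from the crude bound $\|T\|_q \le 2$ gives the sharp interpolation constant in the limit.

  The same principle (\<open>rayleigh_quotient_maximiser\<close>) has two further uses. For $p = 2$ it
  converts the hypothesis on the spectrum into $\|T\|_2 \le \varepsilon$ without a spectral theorem, and
  for the $p$-energy it produces a nonzero eigenvalue of $\Delta_p$. A least one exists because normalised
  eigenfunctions with $\sum_s d(s) \{f(s)\}^{p-1} = 0$ form a compact set, on which the Rayleigh quotient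
  never vanishes.
\<close>

section \<open>Signed powers and convexity of the $p$-th power\<close>

lemma signed_power_uminus: "signed_power (- z) a = - signed_power z a"
  by (simp add: signed_power_def)

lemma signed_power_nonneg: "0 \<le> z \<Longrightarrow> signed_power z a = z powr a"
  by (auto simp: signed_power_def powr_diff)

lemma signed_power_scale: "0 \<le> c \<Longrightarrow> signed_power (c * z) a = c powr a * signed_power z a"
  by (auto simp: signed_power_def abs_mult powr_mult powr_diff)

lemma abs_signed_power: "\<bar>signed_power z a\<bar> = \<bar>z\<bar> powr a"
  by (auto simp: signed_power_def abs_mult powr_diff)

lemma signed_power_mult_self: "signed_power z (p - 1) * z = \<bar>z\<bar> powr p"
proof (cases "z = 0")
  case False
  have "signed_power z (p - 1) * z = \<bar>z\<bar> powr (p - 2) * \<bar>z\<bar> powr 2"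
    using False by (simp add: signed_power_def power2_eq_square)
  also have "\<dots> = \<bar>z\<bar> powr (p - 2 + 2)"
    by (rule powr_add [symmetric])
  also have "\<dots> = \<bar>z\<bar> powr p" by simp
  finally show ?thesis .
qed (simp add: signed_power_def)

lemma signed_power_one [simp]: "signed_power z 1 = z"
  by (simp add: signed_power_def)

lemma continuous_on_signed_power:
  assumes "a > 0" "continuous_on S f"
  shows "continuous_on S (\<lambda>x. signed_power (f x) a)"
proof -
  have eq: "signed_power z a = (max z 0) powr a - (max (- z) 0) powr a" for z
    using signed_power_nonneg[of z a] signed_power_nonneg[of "- z" a]
      signed_power_uminus[of z a] \<open>a > 0\<close> by (cases "z \<ge> 0") (auto simp: max_def)
  show ?thesis
    unfolding eq using assms by (intro continuous_intros continuous_on_powr') auto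
qed

lemma continuous_on_abs_powr:
  fixes f :: "'a::topological_space \<Rightarrow> real"
  assumes "p > 0" "continuous_on S f"
  shows "continuous_on S (\<lambda>x. \<bar>f x\<bar> powr p)"
  using assms by (intro continuous_intros continuous_on_powr') auto

lemma DERIV_abs_powr:
  assumes "p > 1"
  shows "((\<lambda>z. \<bar>z\<bar> powr p) has_real_derivative p * signed_power z (p - 1)) (at z)"
proof (cases "z = 0")
  case True
  have "isCont (\<lambda>z. signed_power z (p - 1)) 0"
    using continuous_on_signed_power[of "p - 1" UNIV "\<lambda>z. z"] assms
    by (simp add: continuous_on_eq_continuous_at)
  then have "((\<lambda>z. \<bar>z\<bar> powr p) has_real_derivative 0) (at 0)"
    unfolding CARAT_DERIV
    by (intro exI[of _ "\<lambda>z. signed_power z (p - 1)"])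
      (simp add: signed_power_mult_self, simp add: signed_power_def)
  with True show ?thesis by (simp add: signed_power_def)
next
  case False
  have "((\<lambda>y. sgn z * y) has_real_derivative sgn z) (at z)"
    by (auto intro!: derivative_eq_intros)
  then have abs_deriv: "((\<lambda>z. \<bar>z\<bar>) has_real_derivative sgn z) (at z)"
    by (rule has_field_derivative_transform_within_open
        [where S = "if z > 0 then {0<..} else {..<0}"]) (use False in \<open>auto simp: sgn_if split: if_splits\<close>)
  have "((\<lambda>z. \<bar>z\<bar> powr p) has_real_derivative p * \<bar>z\<bar> powr (p - 1) * sgn z) (at z)"
    using DERIV_chain2[OF has_real_derivative_powr[of "\<bar>z\<bar>" p] abs_deriv] False by simp
  moreover have "\<bar>z\<bar> powr (p - 1) * sgn z = signed_power z (p - 1)"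
    using False by (auto simp: signed_power_def sgn_if powr_diff powr_add field_simps power2_eq_square)
  ultimately show ?thesis by (simp add: mult.assoc)
qed

lemma powr_superadditive:
  assumes "0 \<le> b" "0 \<le> c" "1 \<le> (q::real)"
  shows "b powr q + c powr q \<le> (b + c) powr q"
proof -
  have *: "x powr q \<le> x * (b + c) powr (q - 1)" if "0 \<le> x" "x \<le> b + c" for x
  proof (cases "x = 0")
    case False
    then have "x powr q = x * x powr (q - 1)" using that by (simp add: powr_diff)
    then show ?thesis using that assms by (simp add: mult_left_mono powr_mono2)
  qed (use assms in simp)
  have "b powr q + c powr q \<le> (b + c) * (b + c) powr (q - 1)"
    using *[of b] *[of c] assms by (simp add: distrib_right)
  also have "\<dots> = (b + c) powr q"
    using assms by (cases "b + c = 0") (auto simp: powr_diff)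
  finally show ?thesis .
qed

text \<open>
  Convexity at the midpoint; the case of a vanishing argument is separate because
  \<open>powr_convex\<close> covers the open half-line.
\<close>

lemma powr_midpoint:
  assumes "0 \<le> b" "0 \<le> c" "1 \<le> (q::real)"
  shows "2 powr (1 - q) * (b + c) powr q \<le> b powr q + c powr q"
proof (cases "b = 0 \<or> c = 0")
  case True
  have "2 powr (1 - q) * (b + c) powr q \<le> (b + c) powr q"
    using powr_mono[of "1 - q" 0 2] assms by (intro mult_left_le_one_le) auto
  with True show ?thesis using assms by auto
next
  case False
  have "((1 - 1/2) *\<^sub>R b + (1/2) *\<^sub>R c) powr q \<le> (1 - 1/2) * b powr q + (1/2) * c powr q"
    using False assms by (intro convex_onD[OF powr_convex]) auto
  then have "2 * ((b + c) / 2) powr q \<le> b powr q + c powr q"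
    by (simp add: field_simps)
  then show ?thesis using assms by (simp add: powr_divide powr_diff)
qed

text \<open>
  For arguments of equal sign superadditivity even gives the constant $1$; the constant
  $2^{1-q}$ comes from arguments of opposite sign, where it is attained at $b = -a$.
\<close>

lemma signed_power_strongly_monotone:
  assumes "b \<le> a" "1 \<le> q"
  shows "2 powr (1 - q) * (a - b) powr q \<le> signed_power a q - signed_power b q"
proof -
  have le1: "2 powr (1 - q) * x \<le> x" if "0 \<le> x" for x :: real
    using that assms powr_mono[of "1 - q" 0 2] by (intro mult_left_le_one_le) auto
  have same_sign: "2 powr (1 - q) * (a - b) powr q \<le> signed_power a q - signed_power b q"
    if "0 \<le> b" "b \<le> a" for a b
    using powr_superadditive[of b "a - b" q] le1[of "(a - b) powr q"] that assms
    by (simp add: signed_power_nonneg)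
  consider "0 \<le> b" | "a \<le> 0" | "b \<le> 0" "0 \<le> a" by linarith
  then show ?thesis
  proof cases
    case 1 then show ?thesis using same_sign assms by simp
  next
    case 2 then show ?thesis using same_sign[of "- a" "- b"] assms
      by (simp add: signed_power_uminus)
  next
    case 3 then show ?thesis using powr_midpoint[of a "- b" q] assms signed_power_uminus[of b q]
      by (simp add: signed_power_nonneg)
  qed
qed

text \<open>
  The difference of the two sides vanishes at $h = 0$, and its derivative in $h$ is
  $p (\{x + h\}^{p-1} - \{x\}^{p-1} - 2^{2-p} \{h\}^{p-1})$, which has the sign of $h$ by strong
  monotonicity with $q = p - 1$.
\<close>

lemma abs_powr_tangent:
  fixes p x h :: real
  assumes "p \<ge> 2"
  shows "\<bar>x\<bar> powr p + p * signed_power x (p - 1) * h + 2 powr (2 - p) * \<bar>h\<bar> powr p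
    \<le> \<bar>x + h\<bar> powr p"
proof -
  have pos: "\<bar>x\<bar> powr p + p * signed_power x (p - 1) * h + 2 powr (2 - p) * \<bar>h\<bar> powr p
    \<le> \<bar>x + h\<bar> powr p" if "h \<ge> 0" for x h
  proof -
    define g where "g h = \<bar>x + h\<bar> powr p - \<bar>x\<bar> powr p - p * signed_power x (p - 1) * h
        - 2 powr (2 - p) * \<bar>h\<bar> powr p" for h
    define g' where "g' h = p * (signed_power (x + h) (p - 1) - signed_power x (p - 1)
        - 2 powr (2 - p) * signed_power h (p - 1))" for h
    have "(g has_real_derivative g' h) (at h)" for h
    proof -
      have "((\<lambda>h. \<bar>x + h\<bar> powr p) has_real_derivative p * signed_power (x + h) (p - 1)) (at h)"
        using DERIV_abs_powr[of p "h + x"] assms DERIV_shift[of "\<lambda>z. \<bar>z\<bar> powr p" _ h x]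
        by (simp add: add.commute)
      moreover have "((\<lambda>h. \<bar>h\<bar> powr p) has_real_derivative p * signed_power h (p - 1)) (at h)"
        using assms by (intro DERIV_abs_powr) simp
      ultimately have "(g has_real_derivative p * signed_power (x + h) (p - 1) - 0
          - p * signed_power x (p - 1) * 1 - 2 powr (2 - p) * (p * signed_power h (p - 1))) (at h)"
        unfolding g_def[abs_def] by (intro DERIV_diff DERIV_cmult DERIV_const DERIV_ident)
      then show ?thesis by (simp add: g'_def algebra_simps)
    qed
    moreover have "g' y \<ge> 0" if "y \<ge> 0" for y
      using signed_power_strongly_monotone[of x "x + y" "p - 1"] that assms
      by (simp add: g'_def signed_power_nonneg)
    ultimately have "g 0 \<le> g h"
      using that by (intro DERIV_nonneg_imp_nondecreasing[of 0 h g]) blast+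
    then show ?thesis using assms by (simp add: g_def)
  qed
  show ?thesis
  proof (cases "h \<ge> 0")
    case False
    with pos[of "- h" "- x"] show ?thesis
      by (simp add: signed_power_uminus abs_minus_commute add.commute)
  qed (rule pos)
qed


lemma DERIV_abs_powr_affine:
  assumes "p > 1"
  shows "((\<lambda>h. \<bar>a + h * b\<bar> powr p) has_real_derivative p * (b * signed_power a (p - 1))) (at 0)"
proof -
  have "((\<lambda>h. a + h * b) has_real_derivative b) (at 0)"
    by (auto intro!: derivative_eq_intros)
  moreover have "((\<lambda>z. \<bar>z\<bar> powr p) has_real_derivative p * signed_power a (p - 1)) (at (a + 0 * b))"
    using DERIV_abs_powr[OF assms, of a] by simp
  ultimately have "((\<lambda>h. \<bar>a + h * b\<bar> powr p) has_real_derivative p * signed_power a (p - 1) * b) (at 0)"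
    by (rule DERIV_chain2 [rotated])
  then show ?thesis
    by (simp only: mult_ac)
qed

text \<open>
  Averaging the tangent inequality at the weighted mean makes its linear term vanish.
\<close>

lemma weighted_jensen_abs_powr:
  fixes w y :: "'i \<Rightarrow> real"
  assumes "finite I" "\<And>i. i \<in> I \<Longrightarrow> 0 \<le> w i" "sum w I > 0" "p \<ge> 2"
  shows "sum w I * \<bar>(\<Sum>i\<in>I. w i * y i) / sum w I\<bar> powr p \<le> (\<Sum>i\<in>I. w i * \<bar>y i\<bar> powr p)"
proof -
  define x where "x = (\<Sum>i\<in>I. w i * y i) / sum w I"
  have "\<bar>x\<bar> powr p + p * signed_power x (p - 1) * (y i - x) \<le> \<bar>y i\<bar> powr p" for i
  proof -
    have "0 \<le> 2 powr (2 - p) * \<bar>y i - x\<bar> powr p" by simp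
    moreover have "\<bar>x\<bar> powr p + p * signed_power x (p - 1) * (y i - x)
        + 2 powr (2 - p) * \<bar>y i - x\<bar> powr p \<le> \<bar>y i\<bar> powr p"
      using abs_powr_tangent[OF \<open>p \<ge> 2\<close>, of x "y i - x"] by simp
    ultimately show ?thesis by linarith
  qed
  then have "(\<Sum>i\<in>I. w i * (\<bar>x\<bar> powr p + p * signed_power x (p - 1) * (y i - x)))
      \<le> (\<Sum>i\<in>I. w i * \<bar>y i\<bar> powr p)"
    using assms by (intro sum_mono mult_left_mono) auto
  moreover have "(\<Sum>i\<in>I. w i * (\<bar>x\<bar> powr p + p * signed_power x (p - 1) * (y i - x)))
      = sum w I * \<bar>x\<bar> powr p + p * signed_power x (p - 1) * ((\<Sum>i\<in>I. w i * y i) - sum w I * x)"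
    by (simp add: sum.distrib sum_distrib_left sum_distrib_right algebra_simps sum_subtractf)
  moreover have "(\<Sum>i\<in>I. w i * y i) = sum w I * x"
    using assms by (simp add: x_def)
  ultimately show ?thesis unfolding x_def [symmetric] by simp
qed

lemma abs_powr_add_le:
  fixes a b :: real
  assumes "p \<ge> 2" "0 < \<delta>" "\<delta> < 1"
  shows "\<bar>a + b\<bar> powr p \<le> (1 - \<delta>) powr (1 - p) * \<bar>a\<bar> powr p + \<delta> powr (1 - p) * \<bar>b\<bar> powr p"
proof -
  have "\<bar>a + b\<bar> powr p \<le> (1 - \<delta>) * \<bar>a / (1 - \<delta>)\<bar> powr p + \<delta> * \<bar>b / \<delta>\<bar> powr p"
    using weighted_jensen_abs_powr[of "{True, False}" "\<lambda>i. if i then 1 - \<delta> else \<delta>" p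
        "\<lambda>i. if i then a / (1 - \<delta>) else b / \<delta>"] assms by simp
  then show ?thesis
    using assms by (simp add: abs_divide powr_divide powr_diff)
qed

text \<open>
  In terms of weighted $L^p$ norms: if $\|u\| \le \delta \|v\|$ then $(1 - \delta) \|v\| \le \|v - u\|$.
  Splitting $v = (v - u) + u$ with convexity weights $1 - \delta$ and $\delta$ reaches the constant of
  Minkowski's inequality directly.
\<close>

lemma weighted_powr_sum_perturb:
  fixes w u v :: "'i \<Rightarrow> real"
  assumes "finite I" "\<And>i. i \<in> I \<Longrightarrow> 0 \<le> w i" "p \<ge> 2" "0 < \<delta>" "\<delta> < 1"
    and small: "(\<Sum>i\<in>I. w i * \<bar>u i\<bar> powr p) \<le> \<delta> powr p * (\<Sum>i\<in>I. w i * \<bar>v i\<bar> powr p)"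
  shows "(1 - \<delta>) powr p * (\<Sum>i\<in>I. w i * \<bar>v i\<bar> powr p) \<le> (\<Sum>i\<in>I. w i * \<bar>v i - u i\<bar> powr p)"
proof -
  let ?V = "\<Sum>i\<in>I. w i * \<bar>v i\<bar> powr p" and ?D = "\<Sum>i\<in>I. w i * \<bar>v i - u i\<bar> powr p"
    and ?U = "\<Sum>i\<in>I. w i * \<bar>u i\<bar> powr p"
  have "?V \<le> (\<Sum>i\<in>I. w i * ((1 - \<delta>) powr (1 - p) * \<bar>v i - u i\<bar> powr p
      + \<delta> powr (1 - p) * \<bar>u i\<bar> powr p))"
  proof (intro sum_mono mult_left_mono)
    fix i assume "i \<in> I"
    show "\<bar>v i\<bar> powr p \<le> (1 - \<delta>) powr (1 - p) * \<bar>v i - u i\<bar> powr p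
        + \<delta> powr (1 - p) * \<bar>u i\<bar> powr p"
      using abs_powr_add_le[OF assms(3-5), of "v i - u i" "u i"] by simp
  qed (use assms in simp)
  also have "\<dots> = (1 - \<delta>) powr (1 - p) * ?D + \<delta> powr (1 - p) * ?U"
    by (simp add: sum.distrib sum_distrib_left algebra_simps)
  also have "\<dots> \<le> (1 - \<delta>) powr (1 - p) * ?D + \<delta> powr (1 - p) * (\<delta> powr p * ?V)"
    using small by (intro add_left_mono mult_left_mono) auto
  also have "\<delta> powr (1 - p) * (\<delta> powr p * ?V) = \<delta> * ?V"
    using assms by (simp add: powr_diff)
  finally have "(1 - \<delta>) * ?V \<le> (1 - \<delta>) powr (1 - p) * ?D" by (simp add: algebra_simps)
  then have "(1 - \<delta>) powr (p - 1) * ((1 - \<delta>) * ?V) \<le> (1 - \<delta>) powr (p - 1) * ((1 - \<delta>) powr (1 - p) * ?D)"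
    by (intro mult_left_mono) auto
  then show ?thesis using assms by (simp add: powr_diff)
qed

section \<open>Extremisers of Rayleigh quotients\<close>

definition linear_form_energy ::
    "'i set \<Rightarrow> ('i \<Rightarrow> real) \<Rightarrow> ('i \<Rightarrow> 'v::finite \<Rightarrow> real) \<Rightarrow> real \<Rightarrow> ('v \<Rightarrow> real) \<Rightarrow> real" where
  "linear_form_energy I w k p f = (\<Sum>i\<in>I. w i * \<bar>\<Sum>t\<in>UNIV. k i t * f t\<bar> powr p)"

definition power_mass :: "('v::finite \<Rightarrow> real) \<Rightarrow> real \<Rightarrow> ('v \<Rightarrow> real) \<Rightarrow> real" where
  "power_mass d p f = (\<Sum>s\<in>UNIV. d s * \<bar>f s\<bar> powr p)"

lemma power_mass_nonneg: "(\<And>s. d s > 0) \<Longrightarrow> 0 \<le> power_mass d p f"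
  by (auto simp: power_mass_def less_imp_le intro!: sum_nonneg)

lemma power_mass_pos:
  assumes "\<And>s. d s > 0" "f \<noteq> (\<lambda>_. 0)"
  shows "0 < power_mass d p f"
proof -
  obtain s where "f s \<noteq> 0" using assms(2) by auto
  then have "0 < d s * \<bar>f s\<bar> powr p" using assms by simp
  also have "\<dots> \<le> power_mass d p f"
    unfolding power_mass_def using assms(1)
    by (intro member_le_sum) (auto simp: less_imp_le)
  finally show ?thesis .
qed

lemma power_mass_scale: "power_mass d p (\<lambda>s. c * f s) = \<bar>c\<bar> powr p * power_mass d p f"
  by (simp add: power_mass_def abs_mult powr_mult sum_distrib_left mult_ac)

lemma linear_form_energy_scale:
  "linear_form_energy I w k p (\<lambda>s. c * f s) = \<bar>c\<bar> powr p * linear_form_energy I w k p f"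
proof -
  have "(\<Sum>t\<in>UNIV. k i t * (c * f t)) = c * (\<Sum>t\<in>UNIV. k i t * f t)" for i
    by (simp add: sum_distrib_left mult_ac)
  then show ?thesis
    by (simp add: linear_form_energy_def abs_mult powr_mult,
        subst sum_distrib_left, simp add: mult.left_commute)
qed

lemma power_mass_variation:
  assumes "p > 1"
  shows "((\<lambda>h. power_mass d p (\<lambda>t. f t + h * of_bool (t = s)))
    has_real_derivative p * (d s * signed_power (f s) (p - 1))) (at 0)"
proof -
  have "((\<lambda>h. power_mass d p (\<lambda>t. f t + h * of_bool (t = s))) has_real_derivative
      (\<Sum>t\<in>UNIV. d t * (p * (of_bool (t = s) * signed_power (f t) (p - 1))))) (at 0)"
    unfolding power_mass_def using assms
    by (intro DERIV_sum DERIV_cmult DERIV_abs_powr_affine) auto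
  moreover have "(\<Sum>t\<in>UNIV. d t * (p * (of_bool (t = s) * signed_power (f t) (p - 1))))
      = p * (d s * signed_power (f s) (p - 1))"
    by (simp add: of_bool_def if_distrib if_distribR sum.delta cong: if_cong)
  ultimately show ?thesis by simp
qed

lemma linear_form_energy_variation:
  assumes "p > 1"
  shows "((\<lambda>h. linear_form_energy I w k p (\<lambda>t. f t + h * of_bool (t = s))) has_real_derivative
    p * (\<Sum>i\<in>I. w i * (k i s * signed_power (\<Sum>t\<in>UNIV. k i t * f t) (p - 1)))) (at 0)"
proof -
  have form: "(\<Sum>t\<in>UNIV. k i t * (f t + h * of_bool (t = s))) = (\<Sum>t\<in>UNIV. k i t * f t) + h * k i s" for i h
  proof -
    have "(\<Sum>t\<in>UNIV. k i t * (h * of_bool (t = s))) = (\<Sum>t\<in>UNIV. if t = s then h * k i s else 0)"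
      by (intro sum.cong) auto
    then show ?thesis by (simp add: distrib_left sum.distrib)
  qed
  have "((\<lambda>h. linear_form_energy I w k p (\<lambda>t. f t + h * of_bool (t = s))) has_real_derivative
      (\<Sum>i\<in>I. w i * (p * (k i s * signed_power (\<Sum>t\<in>UNIV. k i t * f t) (p - 1))))) (at 0)"
    unfolding linear_form_energy_def form using assms
    by (intro DERIV_sum DERIV_cmult DERIV_abs_powr_affine) auto
  then show ?thesis by (simp add: sum_distrib_left mult_ac)
qed

lemma continuous_on_power_mass:
  assumes "p > 0"
  shows "continuous_on S (\<lambda>x. power_mass d p (\<lambda>t. x $ t))"
  unfolding power_mass_def using assms
  by (intro continuous_intros continuous_on_abs_powr) auto

lemma continuous_on_linear_form_energy:
  assumes "p > 0"
  shows "continuous_on S (\<lambda>x. linear_form_energy I w k p (\<lambda>t. x $ t))"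
  unfolding linear_form_energy_def using assms
  by (intro continuous_intros continuous_on_abs_powr) auto

text \<open>
  The quotient of two $p$-homogeneous functionals is determined by its values on the unit sphere,
  where it attains its maximum $m$. There the energy minus $m$ times the mass has a global maximum,
  equal to $0$, so its partial derivatives vanish; up to the factor $p$ they are the two sides of the
  Euler-Lagrange equation.
\<close>

lemma rayleigh_quotient_maximiser:
  fixes k :: "'i \<Rightarrow> 'v::finite \<Rightarrow> real"
  assumes d: "\<And>s. d s > 0" and p: "p > 1"
  shows "\<exists>f m. f \<noteq> (\<lambda>_. 0)
    \<and> (\<forall>g. linear_form_energy I w k p g \<le> m * power_mass d p g)
    \<and> linear_form_energy I w k p f = m * power_mass d p f
    \<and> (\<forall>s. (\<Sum>i\<in>I. w i * (k i s * signed_power (\<Sum>t\<in>UNIV. k i t * f t) (p - 1)))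
          = m * (d s * signed_power (f s) (p - 1)))"
proof -
  let ?E = "linear_form_energy I w k p" and ?D = "power_mass d p"
  let ?S = "sphere (0 :: real ^ 'v) 1"
  have mass_pos: "?D (\<lambda>t. x $ t) > 0" if "x \<in> ?S" for x
  proof -
    have "x \<noteq> 0" using that by auto
    then have "(\<lambda>t. x $ t) \<noteq> (\<lambda>_. 0)" by (auto simp: vec_eq_iff fun_eq_iff)
    then show ?thesis using power_mass_pos d by blast
  qed
  have "continuous_on ?S (\<lambda>x. ?E (\<lambda>t. x $ t) / ?D (\<lambda>t. x $ t))"
  proof (intro continuous_on_divide continuous_on_power_mass continuous_on_linear_form_energy ballI)
    show "?D (\<lambda>t. x $ t) \<noteq> 0" if "x \<in> ?S" for x
      using mass_pos[OF that] by (rule less_imp_neq[symmetric])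
  qed (use p in auto)
  moreover have "axis undefined 1 \<in> ?S" by (simp add: norm_axis_1)
  ultimately obtain x where x: "x \<in> ?S"
    and x_max: "\<And>y. y \<in> ?S \<Longrightarrow> ?E (\<lambda>t. y $ t) / ?D (\<lambda>t. y $ t) \<le> ?E (\<lambda>t. x $ t) / ?D (\<lambda>t. x $ t)"
    using continuous_attains_sup[OF compact_sphere] by blast
  define f where "f t = x $ t" for t
  define m where "m = ?E f / ?D f"
  have Df: "?D f > 0" using mass_pos[OF x] by (simp add: f_def[abs_def])
  have fnz: "f \<noteq> (\<lambda>_. 0)" using Df by (auto simp: power_mass_def)
  have max: "?E g \<le> m * ?D g" for g
  proof (cases "g = (\<lambda>_. 0)")
    case True
    then show ?thesis by (simp add: linear_form_energy_def power_mass_def)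
  next
    case False
    define c where "c = 1 / norm (vec_lambda g)"
    have "vec_lambda g \<noteq> 0" using False by (auto simp: vec_eq_iff fun_eq_iff)
    then have c: "c > 0" and "c *\<^sub>R vec_lambda g \<in> ?S" by (auto simp: c_def)
    from x_max[OF this(2)] have "?E (\<lambda>t. c * g t) / ?D (\<lambda>t. c * g t) \<le> m"
      by (simp add: m_def f_def[abs_def])
    then have "?E g / ?D g \<le> m"
      using c by (simp add: power_mass_scale linear_form_energy_scale)
    then show ?thesis using power_mass_pos[of d g p] False d by (simp add: pos_divide_le_eq)
  qed
  have eq: "?E f = m * ?D f" using Df by (simp add: m_def)
  have crit: "(\<Sum>i\<in>I. w i * (k i s * signed_power (\<Sum>t\<in>UNIV. k i t * f t) (p - 1)))
      = m * (d s * signed_power (f s) (p - 1))" for s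
  proof -
    let ?\<phi> = "\<lambda>h. ?E (\<lambda>t. f t + h * of_bool (t = s)) - m * ?D (\<lambda>t. f t + h * of_bool (t = s))"
    have "(?\<phi> has_real_derivative
        p * (\<Sum>i\<in>I. w i * (k i s * signed_power (\<Sum>t\<in>UNIV. k i t * f t) (p - 1)))
        - m * (p * (d s * signed_power (f s) (p - 1)))) (at 0)"
      using p by (intro DERIV_diff DERIV_cmult linear_form_energy_variation power_mass_variation)
    moreover have "\<forall>y. \<bar>0 - y\<bar> < 1 \<longrightarrow> ?\<phi> y \<le> ?\<phi> 0"
      using max eq by simp
    ultimately have "p * (\<Sum>i\<in>I. w i * (k i s * signed_power (\<Sum>t\<in>UNIV. k i t * f t) (p - 1)))
        - m * (p * (d s * signed_power (f s) (p - 1))) = 0"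
      by (intro DERIV_local_max[where d = 1]) auto
    then show ?thesis using p by simp
  qed
  show ?thesis using fnz max eq crit by (intro exI[of _ f] exI[of _ m]) auto
qed

section \<open>Nonzero eigenvalues of the $p$-Laplacian\<close>

lemma sum_pairs:
  fixes h :: "'a::finite \<Rightarrow> 'b::finite \<Rightarrow> real"
  shows "(\<Sum>i\<in>UNIV. h (fst i) (snd i)) = (\<Sum>x\<in>UNIV. \<Sum>y\<in>UNIV. h x y)"
  by (subst sum.cartesian_product) (simp add: case_prod_unfold)

locale connected_weighted_graph =
  fixes \<omega> :: "'v::finite \<Rightarrow> 'v \<Rightarrow> real"
  assumes graph: "weighted_graph \<omega>"
    and connected: "connected_graph \<omega>"
    and two_vertices: "CARD('v) \<ge> 2"
begin

abbreviation deg :: "'v \<Rightarrow> real" where "deg \<equiv> graph_degree \<omega>"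

lemma weight_nonneg [simp]: "0 \<le> \<omega> s t"
  using graph by (simp add: weighted_graph_def)

lemma weight_commute: "\<omega> s t = \<omega> t s"
  using graph by (auto simp: weighted_graph_def)

lemma deg_pos: "deg s > 0"
proof -
  have "\<exists>t. t \<noteq> s"
  proof (rule ccontr)
    assume "\<nexists>t. t \<noteq> s"
    then have "(UNIV :: 'v set) = {s}" by auto
    then have "CARD('v) = 1" by (metis card_1_singleton_iff One_nat_def)
    then show False using two_vertices by simp
  qed
  then obtain t where "t \<noteq> s" by blast
  moreover have "(s, t) \<in> {(x, y). \<omega> x y > 0}\<^sup>*"
    using connected by (simp add: connected_graph_def)
  ultimately obtain y where y: "\<omega> s y > 0" by (auto elim: converse_rtranclE)
  also have "\<omega> s y \<le> deg s"
    unfolding graph_degree_def by (rule member_le_sum) auto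
  finally show ?thesis .
qed

lemma deg_neq_0 [simp]: "deg s \<noteq> 0"
  using deg_pos[of s] by simp

lemma constant_if_equal_on_edges:
  assumes "\<And>s t. \<omega> s t > 0 \<Longrightarrow> f s = f t"
  shows "f s = f t"
proof -
  have "(s, t) \<in> {(x, y). \<omega> x y > 0}\<^sup>*"
    using connected by (simp add: connected_graph_def)
  then show ?thesis by (induction rule: rtrancl_induct) (auto dest: assms)
qed

lemma sum_edges_fst: "(\<Sum>s\<in>UNIV. \<Sum>t\<in>UNIV. \<omega> s t * g s) = (\<Sum>s\<in>UNIV. deg s * g s)"
  by (simp add: graph_degree_def sum_distrib_right)

lemma sum_edges_snd: "(\<Sum>s\<in>UNIV. \<Sum>t\<in>UNIV. \<omega> s t * g t) = (\<Sum>s\<in>UNIV. deg s * g s)"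
  by (subst sum.swap, subst weight_commute) (rule sum_edges_fst)

definition dirichlet :: "real \<Rightarrow> ('v \<Rightarrow> real) \<Rightarrow> real" where
  "dirichlet p f = (\<Sum>s\<in>UNIV. \<Sum>t\<in>UNIV. \<omega> s t * \<bar>f s - f t\<bar> powr p) / 2"

lemma dirichlet_nonneg: "0 \<le> dirichlet p f"
  by (auto simp: dirichlet_def intro!: sum_nonneg)

lemma constant_if_dirichlet_0:
  assumes "dirichlet p f = 0"
  shows "f s = f t"
proof (rule constant_if_equal_on_edges)
  fix s t assume pos: "\<omega> s t > 0"
  have "\<omega> s t * \<bar>f s - f t\<bar> powr p \<le> (\<Sum>t\<in>UNIV. \<omega> s t * \<bar>f s - f t\<bar> powr p)"
    by (rule member_le_sum) auto
  also have "\<dots> \<le> (\<Sum>s\<in>UNIV. \<Sum>t\<in>UNIV. \<omega> s t * \<bar>f s - f t\<bar> powr p)"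
    by (rule member_le_sum[of s UNIV "\<lambda>s. \<Sum>t\<in>UNIV. \<omega> s t * \<bar>f s - f t\<bar> powr p"])
       (auto intro: sum_nonneg)
  also have "\<dots> = 0" using assms by (simp add: dirichlet_def)
  finally show "f s = f t" using pos by (auto simp: mult_le_0_iff)
qed

text \<open>
  Green's formula: exchanging $s$ and $t$ changes the sign of the signed power.
\<close>

lemma sum_p_laplacian:
  "(\<Sum>s\<in>UNIV. \<phi> s * (\<Sum>t\<in>UNIV. \<omega> s t * signed_power (f s - f t) a))
    = (\<Sum>s\<in>UNIV. \<Sum>t\<in>UNIV. \<omega> s t * (signed_power (f s - f t) a * (\<phi> s - \<phi> t))) / 2"
proof -
  let ?A = "\<Sum>s\<in>UNIV. \<Sum>t\<in>UNIV. \<omega> s t * (signed_power (f s - f t) a * \<phi> s)"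
    and ?B = "\<Sum>s\<in>UNIV. \<Sum>t\<in>UNIV. \<omega> s t * (signed_power (f s - f t) a * \<phi> t)"
  have "\<omega> t s * (signed_power (f t - f s) a * \<phi> s) = - (\<omega> s t * (signed_power (f s - f t) a * \<phi> s))" for s t
    using signed_power_uminus[of "f s - f t" a] weight_commute[of t s] by simp
  then have "?B = - ?A"
    by (subst sum.swap) (simp add: sum_negf)
  moreover have "(\<Sum>s\<in>UNIV. \<Sum>t\<in>UNIV. \<omega> s t * (signed_power (f s - f t) a * (\<phi> s - \<phi> t))) = ?A - ?B"
    by (simp add: algebra_simps sum_subtractf)
  moreover have "(\<Sum>s\<in>UNIV. \<phi> s * (\<Sum>t\<in>UNIV. \<omega> s t * signed_power (f s - f t) a)) = ?A"
    by (simp add: sum_distrib_left mult_ac)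
  ultimately show ?thesis by simp
qed

lemma dirichlet_eq_sum_p_laplacian:
  "dirichlet p f = (\<Sum>s\<in>UNIV. f s * (\<Sum>t\<in>UNIV. \<omega> s t * signed_power (f s - f t) (p - 1)))"
  by (simp add: sum_p_laplacian signed_power_mult_self dirichlet_def)

text \<open>
  The eigenvalue equation is multiplied by the degree, which removes the division from
  \<open>p_laplacian\<close>.
\<close>

definition eigenfunction :: "real \<Rightarrow> real \<Rightarrow> ('v \<Rightarrow> real) \<Rightarrow> bool" where
  "eigenfunction p \<mu> f \<longleftrightarrow> f \<noteq> (\<lambda>_. 0) \<and>
    (\<forall>s. (\<Sum>t\<in>UNIV. \<omega> s t * signed_power (f s - f t) (p - 1)) = \<mu> * (deg s * signed_power (f s) (p - 1)))"

lemma p_laplacian_eigenvalue_iff: "p_laplacian_eigenvalue p \<omega> \<mu> \<longleftrightarrow> (\<exists>f. eigenfunction p \<mu> f)"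
  by (simp add: p_laplacian_eigenvalue_def eigenfunction_def p_laplacian_def field_simps)

lemma eigenfunction_energy:
  assumes "eigenfunction p \<mu> f"
  shows "dirichlet p f = \<mu> * power_mass deg p f"
proof -
  have "dirichlet p f = (\<Sum>s\<in>UNIV. f s * (\<mu> * (deg s * signed_power (f s) (p - 1))))"
    using assms by (simp add: dirichlet_eq_sum_p_laplacian eigenfunction_def)
  also have "\<dots> = (\<Sum>s\<in>UNIV. \<mu> * (deg s * (signed_power (f s) (p - 1) * f s)))"
    by (simp add: mult_ac)
  finally show ?thesis
    by (simp add: power_mass_def sum_distrib_left signed_power_mult_self)
qed

text \<open>
  Green's formula with a constant test function. The conclusion is the first-order condition for $c \mapsto \|f - c\|_p^p$ to be minimal at $c = 0$.
\<close>

lemma eigenfunction_balanced: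
  assumes "eigenfunction p \<mu> f" "\<mu> \<noteq> 0"
  shows "(\<Sum>s\<in>UNIV. deg s * signed_power (f s) (p - 1)) = 0"
proof -
  have "\<mu> * (\<Sum>s\<in>UNIV. deg s * signed_power (f s) (p - 1))
      = (\<Sum>s\<in>UNIV. 1 * (\<Sum>t\<in>UNIV. \<omega> s t * signed_power (f s - f t) (p - 1)))"
    using assms by (simp add: eigenfunction_def sum_distrib_left)
  also have "\<dots> = 0"
    unfolding sum_p_laplacian by simp
  finally show ?thesis using assms by simp
qed

lemma mass_pos: "f \<noteq> (\<lambda>_. 0) \<Longrightarrow> 0 < power_mass deg p f"
  using power_mass_pos deg_pos by blast

text \<open>
  The maximum of the Rayleigh quotient of the $p$-energy is a critical value, hence an eigenvalue. It
  is not $0$, since otherwise every function would have energy $0$ and be constant. The energy has the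
  form required by \<open>rayleigh_quotient_maximiser\<close> with one linear form $f(x) - f(y)$
  for each pair of vertices.
\<close>

lemma nonzero_eigenvalue_exists:
  assumes "p > 1"
  obtains \<mu> f where "\<mu> \<noteq> 0" "eigenfunction p \<mu> f"
proof -
  define k :: "'v \<times> 'v \<Rightarrow> 'v \<Rightarrow> real" where "k i t = of_bool (fst i = t) - of_bool (snd i = t)" for i t
  define w where "w i = \<omega> (fst i) (snd i) / 2" for i
  have delta: "(\<Sum>t\<in>UNIV. of_bool (a = t) * h t) = h a" for a and h :: "'v \<Rightarrow> real"
  proof -
    have "(\<Sum>t\<in>UNIV. of_bool (a = t) * h t) = (\<Sum>t\<in>UNIV. if a = t then h t else 0)"
      by (intro sum.cong) auto
    then show ?thesis by simp
  qed
  have form: "(\<Sum>t\<in>UNIV. k i t * f t) = f (fst i) - f (snd i)" for i f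
    by (simp add: k_def left_diff_distrib sum_subtractf delta)
  have energy: "linear_form_energy UNIV w k p f = dirichlet p f" for f
    using sum_pairs[of "\<lambda>x y. \<omega> x y / 2 * \<bar>f x - f y\<bar> powr p"]
    by (simp add: linear_form_energy_def dirichlet_def w_def form sum_divide_distrib)
  obtain f m where f: "f \<noteq> (\<lambda>_. 0)" and max: "\<forall>g. dirichlet p g \<le> m * power_mass deg p g"
    and crit: "\<forall>s. (\<Sum>i\<in>UNIV. w i * (k i s * signed_power (f (fst i) - f (snd i)) (p - 1)))
      = m * (deg s * signed_power (f s) (p - 1))"
    using rayleigh_quotient_maximiser[where d = deg and p = p and I = UNIV and w = w and k = k,
        OF deg_pos assms] unfolding energy form by blast
  have "(\<Sum>i\<in>UNIV. w i * (k i s * signed_power (f (fst i) - f (snd i)) (p - 1)))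
      = (\<Sum>t\<in>UNIV. \<omega> s t * signed_power (f s - f t) (p - 1))" for s
  proof -
    have "(\<Sum>i\<in>UNIV. w i * (k i s * signed_power (f (fst i) - f (snd i)) (p - 1)))
        = (\<Sum>x\<in>UNIV. \<Sum>y\<in>UNIV. \<omega> x y * (signed_power (f x - f y) (p - 1) *
            (of_bool (s = x) - of_bool (s = y)))) / 2"
      using sum_pairs[of "\<lambda>x y. \<omega> x y / 2 * ((of_bool (x = s) - of_bool (y = s)) * signed_power (f x - f y) (p - 1))"]
      by (simp add: w_def k_def sum_divide_distrib mult_ac eq_commute[of _ s])
    also have "\<dots> = (\<Sum>x\<in>UNIV. of_bool (s = x) * (\<Sum>t\<in>UNIV. \<omega> x t * signed_power (f x - f t) (p - 1)))"
      by (rule sum_p_laplacian [symmetric])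
    finally show ?thesis by (simp add: delta)
  qed
  with f crit have ef: "eigenfunction p m f" by (simp add: eigenfunction_def)
  have "m \<noteq> 0"
  proof
    assume "m = 0"
    define g :: "'v \<Rightarrow> real" where "g t = of_bool (t = undefined)" for t
    have "dirichlet p g = 0" using max[rule_format, of g] dirichlet_nonneg[of p g] \<open>m = 0\<close> by simp
    then have "g t = g undefined" for t by (rule constant_if_dirichlet_0)
    then have "t = undefined" for t :: 'v by (simp add: g_def split: if_splits)
    then have "(UNIV :: 'v set) = {undefined}" by auto
    then have "CARD('v) = 1" by (metis card_1_singleton_iff One_nat_def)
    then show False using two_vertices by simp
  qed
  then show thesis using that ef by blast
qed

text \<open>
  The balance condition $\sum_s d(s) \{f(s)\}^{p-1} = 0$ holds for all eigenfunctions with nonzero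
  eigenvalue, is closed, and excludes constants. Imposing it on unit eigenfunctions therefore gives a
  compact set whose Rayleigh quotients are exactly the nonzero eigenvalues.
\<close>

lemma least_nonzero_eigenvalue_exists:
  assumes "p > 1"
  obtains \<mu> where "\<mu> \<noteq> 0" "p_laplacian_eigenvalue p \<omega> \<mu>"
    "\<And>\<nu>. \<nu> \<noteq> 0 \<Longrightarrow> p_laplacian_eigenvalue p \<omega> \<nu> \<Longrightarrow> \<mu> \<le> \<nu>"
proof -
  let ?D = "\<lambda>x :: real ^ 'v. power_mass deg p (\<lambda>t. x $ t)"
  let ?E = "\<lambda>x :: real ^ 'v. dirichlet p (\<lambda>t. x $ t)"
  let ?S = "sphere (0 :: real ^ 'v) 1"
  \<comment> \<open>The eigenvalue equation with $\lambda$ replaced by $E/D$ and denominators cleared, so that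
    closedness is immediate.\<close>
  define K where "K = ?S
      \<inter> (\<Inter>s. {x. ?D x * (\<Sum>t\<in>UNIV. \<omega> s t * signed_power (x $ s - x $ t) (p - 1))
                = ?E x * (deg s * signed_power (x $ s) (p - 1))})
      \<inter> {x. (\<Sum>s\<in>UNIV. deg s * signed_power (x $ s) (p - 1)) = 0}"
  have cont_E: "continuous_on S ?E" for S
    unfolding dirichlet_def using assms
    by (intro continuous_intros continuous_on_abs_powr) auto
  have cont_D: "continuous_on S ?D" for S
    using assms by (intro continuous_on_power_mass) simp
  have "closed {x :: real ^ 'v. ?D x * (\<Sum>t\<in>UNIV. \<omega> s t * signed_power (x $ s - x $ t) (p - 1))
                = ?E x * (deg s * signed_power (x $ s) (p - 1))}" for s
    using assms
    by (intro closed_Collect_eq continuous_intros continuous_on_signed_power cont_D cont_E) auto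
  moreover have "closed {x :: real ^ 'v. (\<Sum>s\<in>UNIV. deg s * signed_power (x $ s) (p - 1)) = 0}"
    using assms
    by (intro closed_Collect_eq continuous_intros continuous_on_signed_power) auto
  ultimately have "compact K"
    unfolding K_def by (intro compact_Int_closed compact_sphere closed_INT) auto
  have sphere_nz: "(\<lambda>t. x $ t) \<noteq> (\<lambda>_. 0)" if "x \<in> ?S" for x
  proof -
    have "x \<noteq> 0" using that by auto
    then show ?thesis by (auto simp: vec_eq_iff fun_eq_iff)
  qed
  have cont: "continuous_on K (\<lambda>x. ?E x / ?D x)"
  proof (intro continuous_on_divide cont_E cont_D ballI)
    show "?D x \<noteq> 0" if "x \<in> K" for x
      using mass_pos[OF sphere_nz, of x p] that by (simp add: K_def)
  qed
  have eigen_in_K: "\<exists>x\<in>K. ?E x / ?D x = \<nu>" if ef: "eigenfunction p \<nu> f" and "\<nu> \<noteq> 0" for \<nu> f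
  proof -
    define c where "c = 1 / norm (vec_lambda f)"
    define x :: "real ^ 'v" where "x = c *\<^sub>R vec_lambda f"
    have "f \<noteq> (\<lambda>_. 0)" using ef by (simp add: eigenfunction_def)
    then have "vec_lambda f \<noteq> 0" by (auto simp: vec_eq_iff fun_eq_iff)
    then have c: "c > 0" and x: "x \<in> ?S" by (auto simp: c_def x_def)
    have xt: "x $ t = c * f t" for t by (simp add: x_def)
    have "signed_power (x $ s - x $ t) (p - 1) = c powr (p - 1) * signed_power (f s - f t) (p - 1)" for s t
      using signed_power_scale[of c "f s - f t"] c by (simp add: xt right_diff_distrib)
    moreover have "signed_power (x $ s) (p - 1) = c powr (p - 1) * signed_power (f s) (p - 1)" for s
      using signed_power_scale[of c "f s"] c by (simp add: xt)
    ultimately have efx: "eigenfunction p \<nu> (\<lambda>t. x $ t)"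
      using ef sphere_nz[OF x] unfolding eigenfunction_def
      by (simp add: mult.left_commute[of _ "c powr (p - 1)"] flip: sum_distrib_left)
    have "?E x = \<nu> * ?D x" using eigenfunction_energy[OF efx] .
    moreover have "?D x \<noteq> 0" using mass_pos[OF sphere_nz[OF x], of p] by simp
    moreover have "x \<in> K"
      using x eigenfunction_balanced[OF efx \<open>\<nu> \<noteq> 0\<close>] efx \<open>?E x = \<nu> * ?D x\<close>
      by (simp add: K_def eigenfunction_def)
    ultimately show ?thesis by (intro bexI[of _ x]) auto
  qed
  obtain \<nu> f where "\<nu> \<noteq> 0" "eigenfunction p \<nu> f"
    using nonzero_eigenvalue_exists[OF assms] .
  with eigen_in_K have "K \<noteq> {}" by blast
  then obtain x where x: "x \<in> K" and min: "\<And>y. y \<in> K \<Longrightarrow> ?E x / ?D x \<le> ?E y / ?D y"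
    using continuous_attains_inf[OF \<open>compact K\<close> _ cont] by blast
  have nz: "(\<lambda>t. x $ t) \<noteq> (\<lambda>_. 0)" using x sphere_nz by (simp add: K_def)
  have D: "?D x > 0" using mass_pos[OF nz] .
  define \<mu> where "\<mu> = ?E x / ?D x"
  have "eigenfunction p \<mu> (\<lambda>t. x $ t)"
    using x D nz by (simp add: eigenfunction_def K_def \<mu>_def field_simps)
  moreover have "\<mu> \<noteq> 0"
  proof
    assume "\<mu> = 0"
    then have "?E x = 0" using D by (simp add: \<mu>_def)
    then have "x $ s = x $ t" for s t by (rule constant_if_dirichlet_0)
    then obtain c where const: "x $ t = c" for t by blast
    then have "sum deg UNIV * signed_power c (p - 1) = 0"
      using x by (simp add: K_def sum_distrib_right)
    moreover have "sum deg UNIV > 0" using deg_pos by (intro sum_pos) auto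
    ultimately have "c = 0" by (simp add: signed_power_def split: if_splits)
    then show False using nz const by (auto simp: fun_eq_iff)
  qed
  moreover have "\<mu> \<le> \<nu>" if "\<nu> \<noteq> 0" "p_laplacian_eigenvalue p \<omega> \<nu>" for \<nu>
    using that eigen_in_K min unfolding \<mu>_def p_laplacian_eigenvalue_iff by metis
  ultimately show thesis using that p_laplacian_eigenvalue_iff by blast
qed

section \<open>The random walk minus its stationary mean\<close>

abbreviation mass :: "real \<Rightarrow> ('v \<Rightarrow> real) \<Rightarrow> real" where "mass \<equiv> power_mass deg"

definition step :: "('v \<Rightarrow> real) \<Rightarrow> 'v \<Rightarrow> real" where
  "step f s = (\<Sum>t\<in>UNIV. \<omega> s t * f t) / deg s"

definition vol :: real where "vol = sum deg UNIV"

definition mean :: "('v \<Rightarrow> real) \<Rightarrow> real" where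
  "mean f = (\<Sum>s\<in>UNIV. deg s * f s) / vol"

text \<open>
  This is $T = A - A_0$. It annihilates constants and agrees with $A$ on functions of mean $0$, so
  that its norm measures the spectral gap.
\<close>

definition fluct :: "('v \<Rightarrow> real) \<Rightarrow> 'v \<Rightarrow> real" where
  "fluct f s = step f s - mean f"

lemma vol_pos: "vol > 0"
  unfolding vol_def using deg_pos by (intro sum_pos) auto

lemma fluct_kernel: "fluct f s = (\<Sum>t\<in>UNIV. (\<omega> s t / deg s - deg t / vol) * f t)"
  by (simp add: fluct_def step_def mean_def sum_divide_distrib left_diff_distrib sum_subtractf)

lemma deg_step: "deg s * step f s = (\<Sum>t\<in>UNIV. \<omega> s t * f t)"
  by (simp add: step_def)

lemma vol_mean: "vol * mean f = (\<Sum>s\<in>UNIV. deg s * f s)"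
  using vol_pos by (simp add: mean_def)

lemma mean_fluct: "mean (fluct f) = 0"
proof -
  have "vol * mean (fluct f) = (\<Sum>s\<in>UNIV. deg s * (step f s - mean f))"
    by (simp only: vol_mean fluct_def)
  also have "\<dots> = (\<Sum>s\<in>UNIV. deg s * step f s) - vol * mean f"
    by (simp add: right_diff_distrib sum_subtractf vol_def sum_distrib_right)
  also have "\<dots> = 0" unfolding deg_step sum_edges_snd vol_mean by simp
  finally show ?thesis using vol_pos by simp
qed

lemma step_minus_const: "step (\<lambda>s. f s - c) s = step f s - c"
  by (simp add: step_def right_diff_distrib sum_subtractf diff_divide_distrib
      graph_degree_def[symmetric] flip: sum_distrib_right)

lemma mean_minus_const: "mean (\<lambda>s. f s - c) = mean f - c"
  using vol_pos by (simp add: mean_def right_diff_distrib sum_subtractf diff_divide_distrib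
      vol_def[symmetric] flip: sum_distrib_right)

lemma fluct_minus_const: "fluct (\<lambda>s. f s - c) = fluct f"
  by (simp add: fun_eq_iff fluct_def step_minus_const mean_minus_const)

text \<open>
  Both $A$ and $A_0$ are contractions of $L^p(V, d)$ by Jensen's inequality.
\<close>

lemma fluct_crude_bound:
  assumes "p \<ge> 2"
  shows "mass p (fluct f) \<le> 2 powr p * mass p f"
proof -
  have step: "deg s * \<bar>step f s\<bar> powr p \<le> (\<Sum>t\<in>UNIV. \<omega> s t * \<bar>f t\<bar> powr p)" for s
    using weighted_jensen_abs_powr[of UNIV "\<omega> s" p f] deg_pos[of s] assms
    by (simp add: step_def graph_degree_def)
  have mean: "vol * \<bar>mean f\<bar> powr p \<le> mass p f"
    using weighted_jensen_abs_powr[of UNIV deg p f] vol_pos assms deg_pos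
    by (simp add: mean_def vol_def power_mass_def less_imp_le)
  have split: "\<bar>fluct f s\<bar> powr p \<le> 2 powr (p - 1) * (\<bar>step f s\<bar> powr p + \<bar>mean f\<bar> powr p)" for s
  proof -
    have "(1 / 2) powr (1 - p) = (2::real) powr (p - 1)"
      by (simp add: powr_divide powr_diff)
    then show ?thesis
      using abs_powr_add_le[of p "1/2" "step f s" "- mean f"] assms
      by (simp add: fluct_def distrib_left)
  qed
  have "mass p (fluct f) \<le> (\<Sum>s\<in>UNIV. deg s * (2 powr (p - 1) * (\<bar>step f s\<bar> powr p + \<bar>mean f\<bar> powr p)))"
    unfolding power_mass_def using split deg_pos by (intro sum_mono mult_left_mono) (auto simp: less_imp_le)
  also have "\<dots> = 2 powr (p - 1) * ((\<Sum>s\<in>UNIV. deg s * \<bar>step f s\<bar> powr p) + vol * \<bar>mean f\<bar> powr p)"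
    by (simp add: vol_def sum_distrib_left sum_distrib_right distrib_left sum.distrib mult_ac)
  also have "\<dots> \<le> 2 powr (p - 1) * (mass p f + mass p f)"
  proof (intro mult_left_mono add_mono mean)
    have "(\<Sum>s\<in>UNIV. deg s * \<bar>step f s\<bar> powr p) \<le> (\<Sum>s\<in>UNIV. \<Sum>t\<in>UNIV. \<omega> s t * \<bar>f t\<bar> powr p)"
      by (intro sum_mono step)
    then show "(\<Sum>s\<in>UNIV. deg s * \<bar>step f s\<bar> powr p) \<le> mass p f"
      by (simp add: sum_edges_snd power_mass_def)
  qed simp
  also have "\<dots> = 2 powr p * mass p f" by (simp add: powr_diff)
  finally show ?thesis .
qed

text \<open>
  Self-adjointness of $T$ in $L^2(V, d)$ turns the transposed kernel in the Euler-Lagrange equation back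
  into $T$.
\<close>

lemma fluct_maximiser:
  assumes "p > 1"
  shows "\<exists>f m. f \<noteq> (\<lambda>_. 0) \<and> (\<forall>g. mass p (fluct g) \<le> m * mass p g)
    \<and> mass p (fluct f) = m * mass p f
    \<and> (\<forall>s. fluct (\<lambda>i. signed_power (fluct f i) (p - 1)) s = m * signed_power (f s) (p - 1))"
proof -
  define k where "k s t = \<omega> s t / deg s - deg t / vol" for s t
  have form: "(\<Sum>t\<in>UNIV. k s t * g t) = fluct g s" for g s
    by (simp add: fluct_kernel k_def)
  have energy: "linear_form_energy UNIV deg k p g = mass p (fluct g)" for g
    by (simp add: linear_form_energy_def power_mass_def form)
  have symmetric: "deg i * (k i s * h) = deg s * (k s i * h)" for i s h
    using vol_pos weight_commute[of i s] by (simp add: k_def field_simps)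
  obtain f m where f: "f \<noteq> (\<lambda>_. 0)"
    and max: "\<forall>g. mass p (fluct g) \<le> m * mass p g"
    and eq: "mass p (fluct f) = m * mass p f"
    and crit: "\<forall>s. (\<Sum>i\<in>UNIV. deg i * (k i s * signed_power (fluct f i) (p - 1)))
      = m * (deg s * signed_power (f s) (p - 1))"
    using rayleigh_quotient_maximiser[where d = deg and p = p and I = UNIV and w = deg and k = k,
        OF deg_pos assms] unfolding energy form by blast
  have "fluct (\<lambda>i. signed_power (fluct f i) (p - 1)) s = m * signed_power (f s) (p - 1)" for s
  proof -
    have "deg s * fluct (\<lambda>i. signed_power (fluct f i) (p - 1)) s = m * (deg s * signed_power (f s) (p - 1))"
      using crit by (simp add: symmetric form flip: sum_distrib_left)
    then show ?thesis by (simp add: mult.left_commute[of _ "deg s"])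
  qed
  then show ?thesis using f max eq by blast
qed

end

section \<open>From the spectral gap to an $L^p$ bound\<close>

locale graph_spectral_gap = connected_weighted_graph \<omega>
  for \<omega> :: "'v::finite \<Rightarrow> 'v \<Rightarrow> real" +
  fixes \<epsilon> :: real
  assumes eps_pos: "\<epsilon> > 0"
    and spectrum: "laplacian_spectrum \<omega> \<subseteq> {0} \<union> {1 - \<epsilon>..1 + \<epsilon>}"
begin

text \<open>
  If $c \ne 0$, then $g$ lies in the range of $T$ and has mean $0$, so that $Tg = Ag = g - \Delta_2 g$. Thus
  $1 - c$ lies in the spectrum of $\Delta_2$. It is not $0$, because on a connected graph the kernel of
  $\Delta_2$ consists of constants, and $0$ is the only constant of mean $0$.
\<close>

lemma fluct_eigenvalue_bound:
  assumes g: "g \<noteq> (\<lambda>_. 0)" and eigen: "\<And>s. fluct g s = c * g s"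
  shows "\<bar>c\<bar> \<le> \<epsilon>"
proof (cases "c = 0")
  case False
  have "vol * mean (fluct g) = c * (vol * mean g)"
    unfolding vol_mean by (simp add: eigen sum_distrib_left mult_ac)
  then have mean: "mean g = 0" using mean_fluct[of g] vol_pos False by simp
  then have step: "step g s = c * g s" for s using eigen[of s] by (simp add: fluct_def)
  then have "normalized_laplacian \<omega> g s = (1 - c) * g s" for s
    unfolding normalized_laplacian_def using step[of s] by (simp add: step_def left_diff_distrib)
  then have "1 - c \<in> laplacian_spectrum \<omega>"
    using g unfolding laplacian_spectrum_def by blast
  then consider "c = 1" | "1 - c \<in> {1 - \<epsilon>..1 + \<epsilon>}" using spectrum by auto
  then show ?thesis
  proof cases
    case 1
    have "(\<Sum>t\<in>UNIV. \<omega> s t * (g s - g t)) = deg s * g s - deg s * step g s" for s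
      unfolding deg_step by (simp add: right_diff_distrib sum_subtractf graph_degree_def sum_distrib_right)
    then have "dirichlet 2 g = 0"
      using step 1 by (simp add: dirichlet_eq_sum_p_laplacian)
    then have "g s = g t" for s t by (rule constant_if_dirichlet_0)
    then obtain a where a: "g s = a" for s by blast
    then have "vol * a = 0" using vol_mean[of g] mean by (simp add: vol_def sum_distrib_right)
    then show ?thesis using a g vol_pos by (auto simp: fun_eq_iff)
  qed auto
qed (use eps_pos in simp)

text \<open>
  For $p = 2$ the Euler-Lagrange equation reads $T^2 g = m g$, that is,
  $(T - \sqrt m)(T + \sqrt m) g = 0$, so $\sqrt m$ or $-\sqrt m$ is an eigenvalue of $T$.
\<close>

lemma fluct_L2_bound: "mass 2 (fluct f) \<le> \<epsilon>\<^sup>2 * mass 2 f"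
proof -
  obtain g m where g: "g \<noteq> (\<lambda>_. 0)" and max: "\<forall>h. mass 2 (fluct h) \<le> m * mass 2 h"
    and eq: "mass 2 (fluct g) = m * mass 2 g" and sq: "\<forall>s. fluct (fluct g) s = m * g s"
    using fluct_maximiser[of 2] by auto
  have mnn: "m \<ge> 0"
  proof -
    have "0 \<le> m * mass 2 g" using eq power_mass_nonneg[of deg 2 "fluct g"] deg_pos by simp
    then show ?thesis using mass_pos[OF g, of 2] by (simp add: zero_le_mult_iff)
  qed
  define r where "r = sqrt m"
  have r: "r \<ge> 0" "r * r = m" using mnn by (auto simp: r_def)
  define h where "h s = fluct g s + r * g s" for s
  have lin: "fluct h s = fluct (fluct g) s + r * fluct g s" for s
    by (simp add: fluct_kernel[of h] h_def distrib_left sum.distrib fluct_kernel[of "fluct g"]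
        sum_distrib_left mult_ac fluct_kernel[of g])
  have "r \<le> \<epsilon>"
  proof (cases "h = (\<lambda>_. 0)")
    case True
    then have "fluct g s = (- r) * g s" for s by (simp add: h_def fun_eq_iff add_eq_0_iff2)
    from fluct_eigenvalue_bound[OF g this] r show ?thesis by simp
  next
    case False
    have "fluct h s = r * h s" for s
      using r by (simp add: lin sq h_def distrib_left flip: mult.assoc)
    from fluct_eigenvalue_bound[OF False this] show ?thesis by simp
  qed
  then have "m \<le> \<epsilon>\<^sup>2" using r by (metis power2_eq_square power_mono)
  then have "m * mass 2 f \<le> \<epsilon>\<^sup>2 * mass 2 f"
    using power_mass_nonneg[of deg 2 f] deg_pos by (intro mult_right_mono) auto
  then show ?thesis using max[rule_format, of f] by simp
qed

text \<open>
  Take $L^2$ norms in $T \{Tf\}^{p-1} = m \{f\}^{p-1}$ for a maximiser $f$, using that the $L^2$ norm of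
  $\{h\}^{p-1}$ is a power of the $L^{2p-2}$ norm of $h$. This is Riesz-Thorin between the exponents
  $2$ and $2p - 2$, with the sharp constant.
\<close>

lemma fluct_interpolation:
  assumes p: "p \<ge> 2" and M: "M \<ge> 0"
    and bound: "\<And>g. mass (2 * p - 2) (fluct g) \<le> M * mass (2 * p - 2) g"
  shows "mass p (fluct g) \<le> \<epsilon> * sqrt M * mass p g"
proof -
  obtain f m where f: "f \<noteq> (\<lambda>_. 0)" and max: "\<forall>h. mass p (fluct h) \<le> m * mass p h"
    and crit: "\<forall>s. fluct (\<lambda>i. signed_power (fluct f i) (p - 1)) s = m * signed_power (f s) (p - 1)"
    using fluct_maximiser[of p] p by auto
  define q where "q = 2 * p - 2"
  have square: "\<bar>signed_power z (p - 1)\<bar> powr 2 = \<bar>z\<bar> powr q" for z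
    by (simp only: abs_signed_power powr_powr q_def) (simp add: algebra_simps)
  have mass2: "mass 2 (\<lambda>s. signed_power (h s) (p - 1)) = mass q h" for h
    unfolding power_mass_def square ..
  have "m\<^sup>2 * mass q f = mass 2 (\<lambda>s. m * signed_power (f s) (p - 1))"
    by (simp add: power_mass_scale mass2)
  also have "\<dots> = mass 2 (fluct (\<lambda>i. signed_power (fluct f i) (p - 1)))"
    by (simp add: crit power_mass_def)
  also have "\<dots> \<le> \<epsilon>\<^sup>2 * mass 2 (\<lambda>i. signed_power (fluct f i) (p - 1))"
    by (rule fluct_L2_bound)
  also have "\<dots> = \<epsilon>\<^sup>2 * mass q (fluct f)" by (simp only: mass2)
  also have "\<dots> \<le> \<epsilon>\<^sup>2 * (M * mass q f)"
    using bound by (intro mult_left_mono) (auto simp: q_def)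
  finally have "m\<^sup>2 * mass q f \<le> (\<epsilon>\<^sup>2 * M) * mass q f" by simp
  then have "m\<^sup>2 \<le> \<epsilon>\<^sup>2 * M" using mass_pos[OF f, of q] by simp
  then have "m \<le> sqrt (\<epsilon>\<^sup>2 * M)" by (rule real_le_rsqrt)
  then have "m \<le> \<epsilon> * sqrt M" using eps_pos by (simp add: real_sqrt_mult)
  then have "m * mass p g \<le> \<epsilon> * sqrt M * mass p g"
    using power_mass_nonneg[of deg p g] deg_pos by (intro mult_right_mono) auto
  then show ?thesis using max[rule_format, of g] by simp
qed

text \<open>
  The factor $(2/\varepsilon)^{2/2^n}$ is the loss from starting at the finite exponent
  $2 + 2^n (p - 2)$ instead of $\infty$. For $n = 0$ the right-hand side is the crude bound; each
  interpolation step halves the exponent of the loss.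
\<close>

lemma fluct_iterated_bound:
  assumes "p \<ge> 2"
  shows "mass p (fluct g) \<le> \<epsilon>\<^sup>2 * 2 powr (p - 2) * (2 / \<epsilon>) powr (2 / 2 ^ n) * mass p g"
  using assms
proof (induction n arbitrary: p g)
  case 0
  have "\<epsilon>\<^sup>2 * 2 powr (p - 2) * (2 / \<epsilon>) powr (2 / 2 ^ 0) = 2 powr p"
    using eps_pos by (simp add: powr_diff power_divide)
  then show ?case using fluct_crude_bound[OF 0] by simp
next
  case (Suc n)
  define M where "M = \<epsilon>\<^sup>2 * 2 powr ((2 * p - 2) - 2) * (2 / \<epsilon>) powr (2 / 2 ^ n)"
  have "M = (\<epsilon> * 2 powr (p - 2) * (2 / \<epsilon>) powr (2 / 2 ^ Suc n))\<^sup>2"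
    using eps_pos by (simp add: M_def power_mult_distrib powr_power algebra_simps)
  then have "sqrt M = \<epsilon> * 2 powr (p - 2) * (2 / \<epsilon>) powr (2 / 2 ^ Suc n)"
    using eps_pos by simp
  moreover have "mass p (fluct g) \<le> \<epsilon> * sqrt M * mass p g"
  proof (rule fluct_interpolation)
    show "mass (2 * p - 2) (fluct h) \<le> M * mass (2 * p - 2) h" for h
      unfolding M_def using Suc.prems by (intro Suc.IH) simp
  qed (use Suc.prems eps_pos in \<open>auto simp: M_def\<close>)
  ultimately show ?case by (simp add: power2_eq_square mult_ac)
qed

lemma fluct_Lp_bound:
  assumes "p \<ge> 2"
  shows "mass p (fluct g) \<le> \<epsilon>\<^sup>2 * 2 powr (p - 2) * mass p g"
proof -
  have "(\<lambda>n. 2 / 2 ^ n :: real) \<longlonglongrightarrow> 0"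
    by (rule LIMSEQ_divide_realpow_zero) simp
  then have "(\<lambda>n. (2 / \<epsilon>) powr (2 / 2 ^ n)) \<longlonglongrightarrow> (2 / \<epsilon>) powr 0"
    using eps_pos by (intro tendsto_powr tendsto_const) auto
  then have "(\<lambda>n. \<epsilon>\<^sup>2 * 2 powr (p - 2) * (2 / \<epsilon>) powr (2 / 2 ^ n) * mass p g)
      \<longlonglongrightarrow> \<epsilon>\<^sup>2 * 2 powr (p - 2) * (2 / \<epsilon>) powr 0 * mass p g"
    by (intro tendsto_mult tendsto_const)
  then have "mass p (fluct g) \<le> \<epsilon>\<^sup>2 * 2 powr (p - 2) * (2 / \<epsilon>) powr 0 * mass p g"
    by (rule LIMSEQ_le_const) (use fluct_iterated_bound[OF assms] in auto)
  then show ?thesis using eps_pos by simp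
qed

end

section \<open>The eigenvalue estimate\<close>

text \<open>
  The estimates \<open>along\<close> and \<open>across\<close> compare $\|f - Af\|_p$ and the norm of
  $Af(s) - f(t)$ over the edges with $\|f - A_0 f\|_p$. Both rest on the fact that
  $A f - A_0 f = T f = T (f - A_0 f)$ is small.
\<close>

lemma (in connected_weighted_graph) eigenvalue_lower_bound:
  assumes ef: "eigenfunction p \<mu> f" and "\<mu> \<noteq> 0" and p: "p \<ge> 2"
    and \<delta>: "0 < \<delta>" "\<delta> < 1"
    and contraction: "\<And>g. mass p (fluct g) \<le> \<delta> powr p * mass p g"
  shows "(1 - \<delta>) powr p * (1 / 2 + 2 powr (1 - p)) \<le> \<mu>"
proof -
  define c where "c = mean f"
  define f0 where "f0 s = f s - c" for s
  have fluct_f0: "fluct f0 = fluct f"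
    unfolding f0_def[abs_def] by (rule fluct_minus_const)
  have fluct_f: "fluct f s = step f s - c" for s by (simp add: fluct_def c_def)
  have centred: "mass p f \<le> mass p f0"
  proof -
    have "\<bar>f s\<bar> powr p - p * c * signed_power (f s) (p - 1) \<le> \<bar>f0 s\<bar> powr p" for s
    proof -
      have "0 \<le> 2 powr (2 - p) * \<bar>- c\<bar> powr p" by simp
      moreover have "\<bar>f s\<bar> powr p - p * c * signed_power (f s) (p - 1)
          + 2 powr (2 - p) * \<bar>- c\<bar> powr p \<le> \<bar>f0 s\<bar> powr p"
        using abs_powr_tangent[OF p, of "f s" "- c"] by (simp add: f0_def mult_ac)
      ultimately show ?thesis by linarith
    qed
    then have "(\<Sum>s\<in>UNIV. deg s * (\<bar>f s\<bar> powr p - p * c * signed_power (f s) (p - 1))) \<le> mass p f0"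
      unfolding power_mass_def using deg_pos by (intro sum_mono mult_left_mono) (auto simp: less_imp_le)
    moreover have "(\<Sum>s\<in>UNIV. deg s * (\<bar>f s\<bar> powr p - p * c * signed_power (f s) (p - 1)))
        = mass p f - p * c * (\<Sum>s\<in>UNIV. deg s * signed_power (f s) (p - 1))"
      by (simp add: power_mass_def right_diff_distrib sum_subtractf sum_distrib_left mult_ac)
    ultimately show ?thesis using eigenfunction_balanced[OF ef \<open>\<mu> \<noteq> 0\<close>] by simp
  qed
  have along: "(1 - \<delta>) powr p * mass p f0 \<le> mass p (\<lambda>s. f s - step f s)"
  proof -
    have "(1 - \<delta>) powr p * (\<Sum>s\<in>UNIV. deg s * \<bar>f0 s\<bar> powr p)
        \<le> (\<Sum>s\<in>UNIV. deg s * \<bar>f0 s - fluct f0 s\<bar> powr p)"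
      using deg_pos p \<delta> contraction[of f0] unfolding power_mass_def
      by (intro weighted_powr_sum_perturb) (auto simp: less_imp_le)
    then show ?thesis by (simp add: power_mass_def fluct_f0 fluct_f) (simp add: f0_def)
  qed
  have across: "(1 - \<delta>) powr p * mass p f0
      \<le> (\<Sum>s\<in>UNIV. \<Sum>t\<in>UNIV. \<omega> s t * \<bar>step f s - f t\<bar> powr p)"
  proof -
    have fst: "(\<Sum>i\<in>UNIV. \<omega> (fst i) (snd i) * \<bar>fluct f0 (fst i)\<bar> powr p) = mass p (fluct f0)"
      using sum_pairs[of "\<lambda>x y. \<omega> x y * \<bar>fluct f0 x\<bar> powr p"] by (simp add: sum_edges_fst power_mass_def)
    have snd: "(\<Sum>i\<in>UNIV. \<omega> (fst i) (snd i) * \<bar>f0 (snd i)\<bar> powr p) = mass p f0"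
      using sum_pairs[of "\<lambda>x y. \<omega> x y * \<bar>f0 y\<bar> powr p"] by (simp add: sum_edges_snd power_mass_def)
    have "(1 - \<delta>) powr p * (\<Sum>i\<in>UNIV. \<omega> (fst i) (snd i) * \<bar>f0 (snd i)\<bar> powr p)
        \<le> (\<Sum>i\<in>UNIV. \<omega> (fst i) (snd i) * \<bar>f0 (snd i) - fluct f0 (fst i)\<bar> powr p)"
      using p \<delta> contraction[of f0] by (intro weighted_powr_sum_perturb) (auto simp: fst snd)
    also have "\<dots> = (\<Sum>s\<in>UNIV. \<Sum>t\<in>UNIV. \<omega> s t * \<bar>step f s - f t\<bar> powr p)"
      using sum_pairs[of "\<lambda>x y. \<omega> x y * \<bar>f0 y - fluct f0 x\<bar> powr p"]
      by (simp add: fluct_f0 fluct_f) (simp add: f0_def abs_minus_commute)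
    finally show ?thesis unfolding snd .
  qed
  let ?x = "\<lambda>s. f s - step f s" and ?h = "\<lambda>s t. step f s - f t"
  have "(\<Sum>s\<in>UNIV. \<Sum>t\<in>UNIV. \<omega> s t * (\<bar>?x s\<bar> powr p + p * signed_power (?x s) (p - 1) * ?h s t
        + 2 powr (2 - p) * \<bar>?h s t\<bar> powr p)) \<le> 2 * dirichlet p f"
  proof -
    have "\<bar>?x s\<bar> powr p + p * signed_power (?x s) (p - 1) * ?h s t + 2 powr (2 - p) * \<bar>?h s t\<bar> powr p
        \<le> \<bar>f s - f t\<bar> powr p" for s t
      using abs_powr_tangent[OF p, of "?x s" "?h s t"] by simp
    then show ?thesis by (simp add: dirichlet_def sum_mono mult_left_mono)
  qed
  moreover have "(\<Sum>s\<in>UNIV. \<Sum>t\<in>UNIV. \<omega> s t * (\<bar>?x s\<bar> powr p + p * signed_power (?x s) (p - 1) * ?h s t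
        + 2 powr (2 - p) * \<bar>?h s t\<bar> powr p))
      = mass p ?x + 2 powr (2 - p) * (\<Sum>s\<in>UNIV. \<Sum>t\<in>UNIV. \<omega> s t * \<bar>?h s t\<bar> powr p)"
  proof -
    have h0: "(\<Sum>t\<in>UNIV. \<omega> s t * ?h s t) = 0" for s
      using deg_step[of s f] by (simp add: right_diff_distrib sum_subtractf graph_degree_def sum_distrib_right)
    have "(\<Sum>t\<in>UNIV. \<omega> s t * (p * signed_power (?x s) (p - 1) * ?h s t))
        = p * signed_power (?x s) (p - 1) * (\<Sum>t\<in>UNIV. \<omega> s t * ?h s t)" for s
      by (simp only: sum_distrib_left mult_ac)
    then have mid: "(\<Sum>t\<in>UNIV. \<omega> s t * (p * signed_power (?x s) (p - 1) * ?h s t)) = 0" for s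
      by (simp only: h0 mult_zero_right)
    have last: "(\<Sum>s\<in>UNIV. \<Sum>t\<in>UNIV. \<omega> s t * (2 powr (2 - p) * \<bar>?h s t\<bar> powr p))
        = 2 powr (2 - p) * (\<Sum>s\<in>UNIV. \<Sum>t\<in>UNIV. \<omega> s t * \<bar>?h s t\<bar> powr p)"
      by (simp add: sum_distrib_left mult.left_commute)
    show ?thesis
      by (simp only: distrib_left sum.distrib mid last sum_edges_fst power_mass_def) simp
  qed
  ultimately have "mass p ?x + 2 powr (2 - p) * (\<Sum>s\<in>UNIV. \<Sum>t\<in>UNIV. \<omega> s t * \<bar>?h s t\<bar> powr p)
      \<le> 2 * \<mu> * mass p f"
    using eigenfunction_energy[OF ef] by simp
  moreover have "2 powr (2 - p) * ((1 - \<delta>) powr p * mass p f0)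
      \<le> 2 powr (2 - p) * (\<Sum>s\<in>UNIV. \<Sum>t\<in>UNIV. \<omega> s t * \<bar>?h s t\<bar> powr p)"
    using across by (intro mult_left_mono) auto
  moreover have "(1 - \<delta>) powr p * (1 + 2 powr (2 - p)) * mass p f0
      = (1 - \<delta>) powr p * mass p f0 + 2 powr (2 - p) * ((1 - \<delta>) powr p * mass p f0)"
    by (simp add: algebra_simps)
  ultimately have "(1 - \<delta>) powr p * (1 + 2 powr (2 - p)) * mass p f0 \<le> 2 * \<mu> * mass p f"
    using along by linarith
  moreover have "(1 - \<delta>) powr p * (1 + 2 powr (2 - p)) * mass p f
      \<le> (1 - \<delta>) powr p * (1 + 2 powr (2 - p)) * mass p f0"
    using centred by (intro mult_left_mono) auto
  ultimately have "(1 - \<delta>) powr p * (1 + 2 powr (2 - p)) * mass p f \<le> 2 * \<mu> * mass p f"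
    by linarith
  moreover have "mass p f > 0"
    using ef mass_pos[of f p] by (simp add: eigenfunction_def)
  ultimately have "(1 - \<delta>) powr p * (1 + 2 powr (2 - p)) \<le> 2 * \<mu>"
    by simp
  moreover have "2 powr (2 - p) = 2 * 2 powr (1 - p)" by (simp add: powr_diff)
  ultimately show ?thesis by (simp add: algebra_simps)
qed

lemma interpolated_norm_powr:
  fixes p \<epsilon> :: real
  assumes "p \<ge> 2" "\<epsilon> > 0"
  shows "(2 powr (1 - 2 / p) * \<epsilon> powr (2 / p)) powr p = \<epsilon>\<^sup>2 * 2 powr (p - 2)"
  using assms by (simp add: powr_mult powr_powr left_diff_distrib)

text \<open>
  The assumption on $\varepsilon$ amounts to $p \delta \le c$ with $c = 2^{1-p}$. Bernoulli's inequality then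
  gives $(1 - \delta)^p > 1 - c$, while $(1 - c)(\frac12 + c) \ge \frac12$ because $c \le \frac12$. Strictness
  is needed for $p = 2$, where the last inequality is an equality.
\<close>

lemma bound_exceeds_half:
  fixes p \<epsilon> :: real
  assumes p: "p \<ge> 2" and "\<epsilon> > 0" and small: "\<epsilon> \<le> 2 * p powr (- p / 2) * 2 powr (- (p\<^sup>2) / 2)"
  defines "\<delta> \<equiv> 2 powr (1 - 2 / p) * \<epsilon> powr (2 / p)"
  shows "\<delta> < 1" and "(1 - \<delta>) powr p * (1 / 2 + 2 powr (1 - p)) > 1 / 2"
proof -
  define c :: real where "c = 2 powr (1 - p)"
  have c: "0 < c" "c \<le> 1 / 2"
    using powr_mono[of "1 - p" "- 1" 2] p by (auto simp: c_def powr_minus)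
  have "\<epsilon> powr (2 / p) \<le> (2 * p powr (- p / 2) * 2 powr (- (p\<^sup>2) / 2)) powr (2 / p)"
    using small p \<open>\<epsilon> > 0\<close> by (intro powr_mono2) auto
  also have "\<dots> = 2 powr (2 / p) * p powr (- 1) * 2 powr (- p)"
    using p by (simp add: powr_mult powr_powr power2_eq_square)
  finally have "\<delta> \<le> 2 powr (1 - 2 / p) * (2 powr (2 / p) * p powr (- 1) * 2 powr (- p))"
    unfolding \<delta>_def by (intro mult_left_mono) auto
  also have "\<dots> = (2 powr (1 - 2 / p) * 2 powr (2 / p) * 2 powr (- p)) / p"
    using p by (simp add: powr_minus field_simps)
  also have "\<dots> = c / p" by (simp add: c_def powr_diff powr_minus divide_inverse)
  finally have p\<delta>: "p * \<delta> \<le> c" using p by (simp add: field_simps)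
  have \<delta>: "\<delta> > 0" using \<open>\<epsilon> > 0\<close> by (simp add: \<delta>_def)
  have "\<delta> \<le> p * \<delta>" using p \<delta> by simp
  with p\<delta> c show "\<delta> < 1" by linarith
  \<comment> \<open>The remainder term of the tangent inequality makes Bernoulli's inequality strict.\<close>
  have "1 - p * \<delta> < (1 - \<delta>) powr p"
  proof -
    have "0 < 2 powr (2 - p) * \<bar>- \<delta>\<bar> powr p" using \<delta> by simp
    then show ?thesis
      using abs_powr_tangent[OF p, of 1 "- \<delta>"] \<open>\<delta> < 1\<close> by (simp add: signed_power_def)
  qed
  then have "1 - c < (1 - \<delta>) powr p" using p\<delta> by linarith
  then have "(1 - c) * (1 / 2 + c) < (1 - \<delta>) powr p * (1 / 2 + c)"
    using c by (intro mult_strict_right_mono) auto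
  moreover have "(1 - c) * (1 / 2 + c) = 1 / 2 + c * (1 / 2 - c)" by (simp add: field_simps)
  moreover have "0 \<le> c * (1 / 2 - c)" using c by simp
  ultimately show "(1 - \<delta>) powr p * (1 / 2 + 2 powr (1 - p)) > 1 / 2"
    unfolding c_def by linarith
qed

theorem theorem3p11:
  fixes \<omega> :: "'v::finite \<Rightarrow> 'v \<Rightarrow> real" and p \<epsilon> :: real
  assumes "weighted_graph \<omega>"
    and "connected_graph \<omega>"
    and "CARD('v) \<ge> 2"
    and "p \<ge> 2"
    and "\<epsilon> > 0"
    and "laplacian_spectrum \<omega> \<subseteq> {0} \<union> {1 - \<epsilon>..1 + \<epsilon>}"
  shows "lambda1 p \<omega> \<ge>
           max 0 (1 - 2 powr (1 - 2 / p) * \<epsilon> powr (2 / p)) powr p * (1 / 2 + 2 powr (1 - p))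
         \<and> (\<epsilon> \<le> 2 * p powr (- p / 2) * 2 powr (- (p\<^sup>2) / 2) \<longrightarrow> lambda1 p \<omega> > 1 / 2)"
proof -
  interpret graph_spectral_gap \<omega> \<epsilon>
    using assms by unfold_locales
  define \<delta> where "\<delta> = 2 powr (1 - 2 / p) * \<epsilon> powr (2 / p)"
  obtain \<mu> where \<mu>: "\<mu> \<noteq> 0" "p_laplacian_eigenvalue p \<omega> \<mu>"
    and least: "\<And>\<nu>. \<nu> \<noteq> 0 \<Longrightarrow> p_laplacian_eigenvalue p \<omega> \<nu> \<Longrightarrow> \<mu> \<le> \<nu>"
    using least_nonzero_eigenvalue_exists[of p] \<open>p \<ge> 2\<close> by auto
  have lambda1: "lambda1 p \<omega> = \<mu>"
    unfolding lambda1_def using \<mu> least by (intro Least_equality) auto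
  obtain f where f: "eigenfunction p \<mu> f"
    using \<mu> p_laplacian_eigenvalue_iff by blast
  have bound: "max 0 (1 - \<delta>) powr p * (1 / 2 + 2 powr (1 - p)) \<le> \<mu>"
  proof (cases "\<delta> < 1")
    case True
    have "mass p (fluct g) \<le> \<delta> powr p * mass p g" for g
      using fluct_Lp_bound[OF \<open>p \<ge> 2\<close>] interpolated_norm_powr[OF \<open>p \<ge> 2\<close> \<open>\<epsilon> > 0\<close>]
      by (simp add: \<delta>_def)
    moreover have "\<delta> > 0" using \<open>\<epsilon> > 0\<close> by (simp add: \<delta>_def)
    ultimately show ?thesis
      using eigenvalue_lower_bound[OF f \<mu>(1) \<open>p \<ge> 2\<close>, of \<delta>] True by (simp add: max_def)
  next
    case False
    \<comment> \<open>The claimed lower bound is $0$, and eigenvalues are nonnegative because the energy is.\<close>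
    have "0 \<le> \<mu> * mass p f"
      using eigenfunction_energy[OF f] dirichlet_nonneg[of p f] by simp
    moreover have "mass p f > 0"
      using f mass_pos[of f p] by (simp add: eigenfunction_def)
    ultimately have "\<mu> \<ge> 0" by (simp add: zero_le_mult_iff)
    then show ?thesis using False by (simp add: max_def)
  qed
  moreover have "\<mu> > 1 / 2" if "\<epsilon> \<le> 2 * p powr (- p / 2) * 2 powr (- (p\<^sup>2) / 2)"
    using bound_exceeds_half[OF \<open>p \<ge> 2\<close> \<open>\<epsilon> > 0\<close> that] bound by (simp add: \<delta>_def max_def)
  ultimately show ?thesis by (simp add: lambda1 \<delta>_def)
qed

end
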